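(* Let $\mathcal H,\mathcal K$ be complex Hilbert spaces and let $A,B\in L(\mathcal H,\mathcal K)$. With respect to the decompositions $\mathcal H=\overline{R(A^* )}\oplus N(A)$ and $\mathcal K=\overline{R(A)}\oplus N(A^* )$ write $$A=\begin{pmatrix} a&0\\0&0\end{pmatrix},\qquad B=\begin{pmatrix} b_{11}&b_{12}\\ b_{21}&b_{22}\end{pmatrix}.$$ The following conditions are equivalent: 1. $A\overset{+}{\leq}B$ (plus order). 2. $$B=\begin{pmatrix} a+yb_{22}x& yb_{22}\\ b_{22}x& b_{22}\end{pmatrix}+\begin{pmatrix} yw&0\\ w&0\end{pmatrix}+\begin{pmatrix} zx& z\\0&0\end{pmatrix}$$ for some $y\in L(N(A^* ),\overline{R(A)})$, $x\in L(\overline{R(A^* )},N(A))$, $w\in L(\overline{R(A^* )},N(A^* ))$ and $z\in L(N(A),\overline{R(A)})$ such that $$R\left(\begin{pmatrix} yw&0\\ w&0\end{pmatrix}\right)\subseteq R(B)\quad\text{and}\quad R\left(\begin{pmatrix} x^*z^*&0\\ z^*&0\end{pmatrix}\right)\subseteq R(B^* ).$$ 3. There exist two projections $\tilde Q\in L(\mathcal K)$ and $Q\in L(\mathcal H)$ such that $A=\tilde QBQ$, $R((I-\tilde Q)BQ)\subseteq R(B)$ and $R((\tilde QB(I-Q))^* )\subseteq R(B^* )$.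
   Context: $L(\mathcal H,\mathcal K)$ is the set of bounded linear operators from $\mathcal H$ to $\mathcal K$, $L(\mathcal H)=L(\mathcal H,\mathcal H)$; $R(T)$ and $N(T)$ are the range and nullspace of $T$. A projection is a bounded idempotent operator (not necessarily orthogonal). Plus order: $A\overset{+}{\leq}B$ if $R(A)\subseteq R(B)$, $R(A^* )\subseteq R(B^* )$ and there are projections $\tilde Q\in L(\mathcal K)$ and $Q\in L(\mathcal H)$ such that $A=\tilde QBQ$. *)

theory Defs
  imports "HOL-Analysis.Analysis"
begin

subsection \<open>Complex Hilbert spaces\<close>

text \<open>
  A complex inner product space is presented as a real inner product space carrying in addition a
  complex scalar multiplication and a sesquilinear form (linear in the first argument) whose real
  part is the underlying real inner product. Hence norm, metric and topology are those
  inherited from \<^class>\<open>real_inner\<close>, and positivity of the form follows.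
\<close>

class complex_inner = real_inner +
  fixes scaleC :: "complex \<Rightarrow> 'a \<Rightarrow> 'a"  (infixr \<open>*\<^sub>C\<close> 75)
    and cinner :: "'a \<Rightarrow> 'a \<Rightarrow> complex"
  assumes scaleC_add_right: "c *\<^sub>C (x + y) = c *\<^sub>C x + c *\<^sub>C y"
    and scaleC_add_left: "(c + d) *\<^sub>C x = c *\<^sub>C x + d *\<^sub>C x"
    and scaleC_scaleC: "c *\<^sub>C d *\<^sub>C x = (c * d) *\<^sub>C x"
    and scaleC_of_real: "complex_of_real r *\<^sub>C x = r *\<^sub>R x"
    and cinner_add_left: "cinner (x + y) z = cinner x z + cinner y z"
    and cinner_scaleC_left: "cinner (c *\<^sub>C x) y = c * cinner x y"
    and cinner_commute: "cinner x y = cnj (cinner y x)"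
    and Re_cinner: "Re (cinner x y) = inner x y"

class complex_hilbert = complex_inner + complete_space

instantiation complex :: complex_hilbert
begin
definition scaleC_complex :: "complex \<Rightarrow> complex \<Rightarrow> complex" where "scaleC_complex = (*)"
definition cinner_complex :: "complex \<Rightarrow> complex \<Rightarrow> complex" where "cinner_complex x y = x * cnj y"
instance
  by standard (auto simp: scaleC_complex_def cinner_complex_def algebra_simps scaleR_conv_of_real
      inner_complex_def)
end

subsection \<open>Bounded operators\<close>

text \<open>
  \<open>bounded_ops M N\<close> is \<open>L(M, N)\<close> for subspaces \<open>M\<close>, \<open>N\<close> of the ambient spaces. Its members are total
  functions of which only the values on \<open>M\<close> are relevant. For the whole spaces take
  \<open>M = UNIV\<close>, \<open>N = UNIV\<close>.
\<close>

definition bounded_ops :: "'a::complex_inner set \<Rightarrow> 'b::complex_inner set \<Rightarrow> ('a \<Rightarrow> 'b) set" where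
  "bounded_ops M N = {T.
     (\<forall>u\<in>M. T u \<in> N) \<and>
     (\<forall>u\<in>M. \<forall>v\<in>M. T (u + v) = T u + T v) \<and>
     (\<forall>c. \<forall>u\<in>M. T (c *\<^sub>C u) = c *\<^sub>C T u) \<and>
     (\<exists>K. \<forall>u\<in>M. norm (T u) \<le> K * norm u)}"

definition nullspace :: "('a \<Rightarrow> 'b::zero) \<Rightarrow> 'a set" where
  "nullspace T = {u. T u = 0}"

text \<open>
  The Hilbert space adjoint of an operator \<open>T \<in> bounded_ops M N\<close>, an element of
  \<open>bounded_ops N M\<close>. The codomain \<open>N\<close> need not be mentioned.
\<close>

definition adjoint_on :: "'a::complex_inner set \<Rightarrow> ('a \<Rightarrow> 'b::complex_inner) \<Rightarrow> 'b \<Rightarrow> 'a" where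
  "adjoint_on M T v = (THE u. u \<in> M \<and> (\<forall>m\<in>M. cinner (T m) v = cinner m u))"

abbreviation cadjoint :: "('a::complex_inner \<Rightarrow> 'b::complex_inner) \<Rightarrow> 'b \<Rightarrow> 'a" where
  "cadjoint \<equiv> adjoint_on UNIV"

definition projection_op :: "('a::complex_inner \<Rightarrow> 'a) \<Rightarrow> bool" where
  "projection_op Q \<longleftrightarrow> Q \<in> bounded_ops UNIV UNIV \<and> Q \<circ> Q = Q"

definition plus_le :: "('a::complex_inner \<Rightarrow> 'b::complex_inner) \<Rightarrow> ('a \<Rightarrow> 'b) \<Rightarrow> bool" where
  "plus_le A B \<longleftrightarrow>
     range A \<subseteq> range B \<and> range (cadjoint A) \<subseteq> range (cadjoint B) \<and>
     (\<exists>Qt Q. projection_op Qt \<and> projection_op Q \<and> A = Qt \<circ> B \<circ> Q)"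


subsection \<open>Operator matrices\<close>

definition orth_proj :: "'a::complex_inner set \<Rightarrow> 'a \<Rightarrow> 'a" where
  "orth_proj M u = (THE m. m \<in> M \<and> (\<forall>n\<in>M. cinner (u - m) n = 0))"

text \<open>
  The entry of the matrix of \<open>T\<close> that maps a summand \<open>M\<close> of the domain to a summand \<open>N\<close> of the codomain;
  its values are relevant on \<open>M\<close> only.
\<close>

definition block_entry :: "'b::complex_inner set \<Rightarrow> ('a \<Rightarrow> 'b) \<Rightarrow> 'a \<Rightarrow> 'b" where
  "block_entry N T u = orth_proj N (T u)"

text \<open>
  \<open>block_op M1 M2 t11 t12 t21 t22\<close> is the operator with matrix \<open>(t11 t12; t21 t22)\<close> relative to an
  orthogonal decomposition of the domain into \<open>M1\<close> and \<open>M2\<close>. The orthogonal decomposition of the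
  codomain is internal: the entries of each row take values in the corresponding summand.
\<close>

definition block_op ::
  "'a::complex_inner set \<Rightarrow> 'a set \<Rightarrow> ('a \<Rightarrow> 'b::complex_inner) \<Rightarrow> ('a \<Rightarrow> 'b) \<Rightarrow> ('a \<Rightarrow> 'b) \<Rightarrow> ('a \<Rightarrow> 'b)
   \<Rightarrow> 'a \<Rightarrow> 'b" where
  "block_op M1 M2 t11 t12 t21 t22 u =
     (t11 (orth_proj M1 u) + t12 (orth_proj M2 u)) + (t21 (orth_proj M1 u) + t22 (orth_proj M2 u))"


subsection \<open>The notions are well defined\<close>

definition csubspace :: "'a::complex_inner set \<Rightarrow> bool" where
  "csubspace M \<longleftrightarrow> 0 \<in> M \<and> (\<forall>u\<in>M. \<forall>v\<in>M. u + v \<in> M) \<and> (\<forall>c. \<forall>u\<in>M. c *\<^sub>C u \<in> M)"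

lemma cinner_add_right: "cinner x (y + z) = cinner x y + cinner x z" for x :: "'a::complex_inner"
  by (metis cinner_add_left cinner_commute complex_cnj_add)
lemma cinner_scaleC_right: "cinner x (c *\<^sub>C y) = cnj c * cinner x y" for x :: "'a::complex_inner"
  by (metis cinner_commute cinner_scaleC_left complex_cnj_mult)
lemma scaleC_m1: "(-1) *\<^sub>C x = - x" for x :: "'a::complex_inner"
  using scaleC_of_real[of "-1" x] by simp
lemma cinner_minus_left: "cinner (- x) y = - cinner x y" for x :: "'a::complex_inner"
  using cinner_scaleC_left[of "-1" x y] by (simp add: scaleC_m1)
lemma cinner_diff_left: "cinner (x - y) z = cinner x z - cinner y z" for x :: "'a::complex_inner"
  using cinner_add_left[of x "-y" z] by (simp add: cinner_minus_left)
lemma cinner_diff_right: "cinner x (y - z) = cinner x y - cinner x z" for x :: "'a::complex_inner"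
  by (metis cinner_diff_left cinner_commute complex_cnj_diff)
lemma cinner_zero_left [simp]: "cinner 0 y = 0" for y :: "'a::complex_inner"
  using cinner_diff_left[of 0 0 y] by simp
lemma cinner_zero_right [simp]: "cinner y 0 = 0" for y :: "'a::complex_inner"
  using cinner_diff_right[of y 0 0] by simp
lemma cinner_self: "cinner x x = of_real ((norm x)\<^sup>2)" for x :: "'a::complex_inner"
proof (rule complex_eqI)
  show "Re (cinner x x) = Re (of_real ((norm x)\<^sup>2))" by (simp add: Re_cinner power2_norm_eq_inner)
  have "Im (cinner x x) = - Im (cinner x x)" using cinner_commute[of x x] by (metis cnj.sel(2))
  then show "Im (cinner x x) = Im (of_real ((norm x)\<^sup>2))" by simp
qed
lemma cinner_self_0: "cinner x x = 0 \<longleftrightarrow> x = 0" for x :: "'a::complex_inner"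
  by (simp add: cinner_self)

lemma norm_scaleC_i: "norm (\<i> *\<^sub>C x) = norm x" for x :: "'a::complex_inner"
proof -
  have "cinner (\<i> *\<^sub>C x) (\<i> *\<^sub>C x) = cinner x x" by (simp add: cinner_scaleC_left cinner_scaleC_right)
  then have "Re (cinner (\<i> *\<^sub>C x) (\<i> *\<^sub>C x)) = Re (cinner x x)" by simp
  then show ?thesis by (simp add: Re_cinner norm_eq_sqrt_inner)
qed
lemma Im_cinner: "Im (cinner x y) = - inner (\<i> *\<^sub>C x) y" for x :: "'a::complex_inner"
  using Re_cinner[of "\<i> *\<^sub>C x" y] by (simp add: cinner_scaleC_left)
lemma cmod_cinner: "cmod (cinner x y) \<le> 2 * norm x * norm y" for x :: "'a::complex_inner"
proof -
  have "cmod (cinner x y) \<le> \<bar>Re (cinner x y)\<bar> + \<bar>Im (cinner x y)\<bar>" by (rule cmod_le)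
  also have "\<dots> \<le> norm x * norm y + norm x * norm y"
    unfolding Im_cinner Re_cinner
    using Cauchy_Schwarz_ineq2[of x y] Cauchy_Schwarz_ineq2[of "\<i> *\<^sub>C x" y] by (simp add: norm_scaleC_i)
  finally show ?thesis by simp
qed

lemma csubspaceD:
  assumes "csubspace M" shows "0 \<in> M" "u \<in> M \<Longrightarrow> v \<in> M \<Longrightarrow> u + v \<in> M" "u \<in> M \<Longrightarrow> c *\<^sub>C u \<in> M"
    "u \<in> M \<Longrightarrow> r *\<^sub>R u \<in> M" "u \<in> M \<Longrightarrow> v \<in> M \<Longrightarrow> u - v \<in> M"
  using assms unfolding csubspace_def
      apply (auto simp flip: scaleC_of_real)
  by (metis add_uminus_conv_diff scaleC_m1)

lemma orth_real_imp: assumes "csubspace M" "\<forall>n\<in>M. inner w n = 0" "n \<in> M" shows "cinner w n = 0"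
proof (rule complex_eqI)
  show "Re (cinner w n) = Re 0" using assms by (simp add: Re_cinner)
  have "inner w (\<i> *\<^sub>C n) = 0" using assms csubspaceD(3) by blast
  then have "Re (cinner w (\<i> *\<^sub>C n)) = 0" by (simp add: Re_cinner)
  then show "Im (cinner w n) = Im 0" by (simp add: cinner_scaleC_right)
qed

text \<open>
  Existence and uniqueness of orthogonal projections onto closed subspaces and of adjoints, so that
  the definite descriptions in \<^const>\<open>orth_proj\<close> and \<^const>\<open>adjoint_on\<close> are attained.
\<close>

lemma proj_exists:
  fixes M :: "'a::complex_hilbert set"
  assumes "csubspace M" "closed M"
  shows "\<exists>m\<in>M. \<forall>n\<in>M. cinner (u - m) n = 0"
proof -
  define d where "d = infdist u M"
  have ne: "M \<noteq> {}" using csubspaceD(1)[OF assms(1)] by auto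
  have dle: "d \<le> norm (u - m)" if "m \<in> M" for m
    using infdist_le[OF that, of u] by (simp add: d_def dist_norm)
  have d0: "d \<ge> 0" by (simp add: d_def infdist_nonneg)
  have "\<exists>m\<in>M. norm (u - m) < d + 1 / real (Suc k)" for k
  proof (rule ccontr)
    assume "\<not> ?thesis"
    then have "\<forall>m\<in>M. d + 1 / real (Suc k) \<le> dist u m" by (auto simp: dist_norm not_less)
    then have "d + 1 / real (Suc k) \<le> infdist u M"
      unfolding infdist_def using ne by (auto intro!: cINF_greatest)
    then show False by (simp add: d_def)
  qed
  then obtain s where s: "\<And>k. s k \<in> M" "\<And>k. norm (u - s k) < d + 1 / real (Suc k)" by metis
  have lim: "(\<lambda>k. norm (u - s k)) \<longlonglongrightarrow> d"
  proof (rule tendsto_sandwich)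
    show "\<forall>\<^sub>F k in sequentially. d \<le> norm (u - s k)" using dle s by auto
    show "\<forall>\<^sub>F k in sequentially. norm (u - s k) \<le> d + 1 / real (Suc k)" by (intro always_eventually allI less_imp_le s(2))
    have "(\<lambda>k. d + 1 / real (Suc k)) \<longlonglongrightarrow> d + 0" by (intro tendsto_intros LIMSEQ_Suc lim_1_over_n)
    then show "(\<lambda>k. d + 1 / real (Suc k)) \<longlonglongrightarrow> d" by simp
  qed simp
  have par: "(norm (s j - s k))\<^sup>2 \<le> 2 * (norm (u - s j))\<^sup>2 + 2 * (norm (u - s k))\<^sup>2 - 4 * d\<^sup>2" for j k
  proof -
    let ?m = "(1/2) *\<^sub>R (s j + s k)"
    have "?m \<in> M" by (intro csubspaceD[OF assms(1)] s(1))
    then have "d\<^sup>2 \<le> (norm (u - ?m))\<^sup>2" using dle d0 by (simp add: power_mono)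
    moreover have "(norm (s j - s k))\<^sup>2 = 2 * (norm (u - s j))\<^sup>2 + 2 * (norm (u - s k))\<^sup>2 - 4 * (norm (u - ?m))\<^sup>2"
      unfolding power2_norm_eq_inner 
      by (simp add: inner_diff_left inner_diff_right inner_add_left inner_add_right
          inner_commute[of "s j" u] inner_commute[of "s k" u] inner_commute[of "s k" "s j"] field_simps)
    ultimately show ?thesis by linarith
  qed
  have "Cauchy s"
  proof (rule metric_CauchyI)
    fix e :: real assume e: "e > 0"
    have "(\<lambda>k. (norm (u - s k))\<^sup>2) \<longlonglongrightarrow> d\<^sup>2" by (intro tendsto_intros lim)
    then obtain N where N: "\<And>k. k \<ge> N \<Longrightarrow> \<bar>(norm (u - s k))\<^sup>2 - d\<^sup>2\<bar> < e\<^sup>2 / 4"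
      using e unfolding LIMSEQ_iff by (metis divide_pos_pos zero_less_numeral zero_less_power real_norm_def)
    have "dist (s j) (s k) < e" if "j \<ge> N" "k \<ge> N" for j k
    proof -
      have "(norm (s j - s k))\<^sup>2 < e\<^sup>2" using par[of j k] N[OF that(1)] N[OF that(2)] by linarith
      then show ?thesis using e by (simp add: dist_norm power2_less_imp_less)
    qed
    then show "\<exists>N. \<forall>m\<ge>N. \<forall>n\<ge>N. dist (s m) (s n) < e" by blast
  qed
  then obtain m where m: "s \<longlonglongrightarrow> m" using Cauchy_convergent convergent_def by blast
  have mM: "m \<in> M" using assms(2) m s(1) closed_sequentially by blast
  have "(\<lambda>k. norm (u - s k)) \<longlonglongrightarrow> norm (u - m)" by (intro tendsto_intros m)
  then have nd: "norm (u - m) = d" using lim LIMSEQ_unique by blast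
  have expand: "(norm (p - (inner p n / inner n n) *\<^sub>R n))\<^sup>2 = (norm p)\<^sup>2 - (inner p n)\<^sup>2 / inner n n"
    if "n \<noteq> 0" for p n :: 'a
    using that unfolding power2_norm_eq_inner
    by (simp add: inner_diff_left inner_diff_right inner_commute[of n p] power2_eq_square)
  have "inner (u - m) n = 0" if n: "n \<in> M" for n
  proof (cases "n = 0")
    case False
    let ?t = "inner (u - m) n / inner n n"
    have "m + ?t *\<^sub>R n \<in> M" by (intro csubspaceD(2,4)[OF assms(1)] mM n)
    then have "norm (u - m) \<le> norm (u - (m + ?t *\<^sub>R n))" using nd dle by metis
    then have "(norm (u - m))\<^sup>2 \<le> (norm ((u - m) - ?t *\<^sub>R n))\<^sup>2" by (simp add: power_mono diff_diff_eq)
    also have "\<dots> = (norm (u - m))\<^sup>2 - (inner (u - m) n)\<^sup>2 / inner n n"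
      using expand[OF False] by simp
    finally have "(inner (u - m) n)\<^sup>2 / inner n n \<le> 0" by simp
    moreover have "inner n n > 0" using False by simp
    ultimately have "(inner (u - m) n)\<^sup>2 \<le> 0" by (simp add: divide_le_0_iff)
    then show ?thesis by simp
  qed simp
  then show ?thesis using mM orth_real_imp[OF assms(1)] by blast
qed

lemma orth_projI:
  assumes "csubspace M" "m \<in> M" "\<forall>n\<in>M. cinner (u - m) n = 0" shows "orth_proj M u = m"
  unfolding orth_proj_def
proof (rule the_equality)
  show "m \<in> M \<and> (\<forall>n\<in>M. cinner (u - m) n = 0)" using assms by blast
  fix p assume p: "p \<in> M \<and> (\<forall>n\<in>M. cinner (u - p) n = 0)"
  have q: "p - m \<in> M" using csubspaceD(5)[OF assms(1)] p assms(2) by blast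
  have "cinner ((u - m) - (u - p)) (p - m) = 0"
    using p assms(3) q cinner_diff_left[of "u-m" "u-p" "p-m"] by simp
  then show "p = m" by (simp add: cinner_self_0)
qed

lemma orth_proj:
  fixes M :: "'a::complex_hilbert set"
  assumes "csubspace M" "closed M"
  shows "orth_proj M u \<in> M" "n \<in> M \<Longrightarrow> cinner (u - orth_proj M u) n = 0"
  using proj_exists[OF assms, of u] orth_projI[OF assms(1), of _ u] by metis+

lemma adjoint_on:
  fixes M :: "'a::complex_hilbert set" and T :: "'a \<Rightarrow> 'b::complex_inner"
  assumes M: "csubspace M" "closed M" and T: "T \<in> bounded_ops M N"
  shows "adjoint_on M T v \<in> M \<and> (\<forall>m\<in>M. cinner (T m) v = cinner m (adjoint_on M T v))"
  unfolding adjoint_on_def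
proof (rule theI')
  have Tadd: "T (x + y) = T x + T y" if "x\<in>M" "y\<in>M" for x y using T that by (auto simp: bounded_ops_def)
  have Tsc: "T (c *\<^sub>C x) = c *\<^sub>C T x" if "x\<in>M" for c x using T that by (auto simp: bounded_ops_def)
  obtain K where K: "norm (T x) \<le> K * norm x" if "x \<in> M" for x using T unfolding bounded_ops_def by blast
  define f where "f m = cinner (T m) v" for m
  have fadd: "f (x + y) = f x + f y" if "x\<in>M" "y\<in>M" for x y using that by (simp add: f_def Tadd cinner_add_left)
  have fsc: "f (c *\<^sub>C x) = c * f x" if "x\<in>M" for c x using that by (simp add: f_def Tsc cinner_scaleC_left)
  have fdf: "f (x - y) = f x - f y" if "x\<in>M" "y\<in>M" for x y
    using that fadd[of "x-y" y] csubspaceD[OF M(1)] by simp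
  have fb: "cmod (f m) \<le> 2 * K * norm v * norm m" if "m \<in> M" for m
  proof -
    have "cmod (f m) \<le> 2 * norm (T m) * norm v" unfolding f_def by (rule cmod_cinner)
    also have "\<dots> \<le> 2 * (K * norm m) * norm v" using K[OF that] by (simp add: mult_right_mono)
    finally show ?thesis by (simp add: mult_ac)
  qed
  define Z where "Z = {m\<in>M. f m = 0}"
  have Zs: "csubspace Z" unfolding csubspace_def Z_def using csubspaceD[OF M(1)] fadd fsc fdf[of 0 0] by auto
  have Zc: "closed Z" unfolding closed_sequential_limits
  proof (intro allI impI)
    fix s l assume a: "(\<forall>n. s n \<in> Z) \<and> s \<longlonglongrightarrow> l"
    then have l: "l \<in> M" using M(2) closed_sequentially[of M s l] by (auto simp: Z_def)
    have b: "cmod (f l) \<le> 2 * K * norm v * norm (l - s n)" for n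
      using fb[of "l - s n"] fdf[of l "s n"] a l csubspaceD(5)[OF M(1)] by (auto simp: Z_def)
    have "(\<lambda>n. 2 * K * norm v * norm (l - s n)) \<longlonglongrightarrow> 2 * K * norm v * norm (l - l)"
      using a by (intro tendsto_intros) auto
    then have "cmod (f l) \<le> 0" using b by (intro LIMSEQ_le_const) auto
    then show "l \<in> Z" using l by (simp add: Z_def)
  qed
  have ex: "\<exists>u\<in>M. \<forall>m\<in>M. f m = cinner m u"
  proof (cases "\<forall>m\<in>M. f m = 0")
    case True then show ?thesis using csubspaceD(1)[OF M(1)] by (intro bexI[of _ 0]) auto
  next
    case False
    then obtain p where p: "p \<in> M" "f p \<noteq> 0" by blast
    let ?q = "p - orth_proj Z p"
    have z: "orth_proj Z p \<in> Z" using orth_proj[OF Zs Zc] by blast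
    have q: "?q \<in> M" "f ?q = f p" using z p csubspaceD(5)[OF M(1)] fdf by (auto simp: Z_def)
    then have q0: "cinner ?q ?q \<noteq> 0" using p fdf[of 0 0] csubspaceD(1)[OF M(1)] cinner_self_0 by (metis diff_self)
    let ?u = "cnj (f ?q / cinner ?q ?q) *\<^sub>C ?q"
    have "f m = cinner m ?u" if m: "m \<in> M" for m
    proof -
      have "m - (f m / f ?q) *\<^sub>C ?q \<in> Z"
      proof -
        have sq: "(f m / f ?q) *\<^sub>C ?q \<in> M" by (rule csubspaceD(3)[OF M(1) q(1)])
        have "f (m - (f m / f ?q) *\<^sub>C ?q) = f m - (f m / f ?q) * f ?q"
          by (simp only: fdf[OF m sq] fsc[OF q(1)])
        also have "\<dots> = 0" using p(2) q(2) by simp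
        finally show ?thesis using csubspaceD(5)[OF M(1) m sq] by (simp add: Z_def)
      qed
      then have "cinner ?q (m - (f m / f ?q) *\<^sub>C ?q) = 0" using orth_proj(2)[OF Zs Zc] by blast
      then have "cinner (m - (f m / f ?q) *\<^sub>C ?q) ?q = 0" by (metis cinner_commute complex_cnj_zero)
      then have e: "cinner m ?q = (f m / f ?q) * cinner ?q ?q" by (simp add: cinner_diff_left cinner_scaleC_left)
      then have "cinner m ?q * f ?q = f m * cinner ?q ?q" using p(2) q(2) by (simp add: e)
      then show ?thesis using q0 unfolding cinner_scaleC_right complex_cnj_cnj by (simp add: divide_simps mult.commute)
    qed
    moreover have "?u \<in> M" by (rule csubspaceD(3)[OF M(1) q(1)])
    ultimately show ?thesis by blast
  qed
  have uniq: "u = u'" if a: "u\<in>M" "u'\<in>M" "\<forall>m\<in>M. cinner m u = cinner m u'" for u u'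
  proof -
    have "u - u' \<in> M" using a csubspaceD(5)[OF M(1)] by blast
    then have "cinner (u - u') (u - u') = 0" using a(3) cinner_diff_right[of "u-u'" u u'] by simp
    then show ?thesis by (simp add: cinner_self_0)
  qed
  show "\<exists>!u. u \<in> M \<and> (\<forall>m\<in>M. cinner (T m) v = cinner m u)"
    using ex uniq unfolding f_def by (metis (no_types, lifting))
qed

lemma csubspace_closure: fixes S :: "'a::complex_inner set" assumes "csubspace S" shows "csubspace (closure S)"
proof -
  have 1: "u + v \<in> closure S" if "u \<in> closure S" "v \<in> closure S" for u v
    using that csubspaceD(2)[OF assms] unfolding closure_sequential by (metis (no_types, lifting) tendsto_add)
  have 2: "c *\<^sub>C u \<in> closure S" if u: "u \<in> closure S" for c and u :: 'a
  proof -
    obtain s where s: "\<And>n. s n \<in> S" "s \<longlonglongrightarrow> u" using u unfolding closure_sequential by blast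
    have i: "bounded_linear (\<lambda>x::'a. \<i> *\<^sub>C x)"
      by (rule bounded_linear_intro[where K=1]) (auto simp: scaleC_add_right norm_scaleC_i simp flip: scaleC_of_real, simp add: scaleC_scaleC mult.commute)
    have e: "c *\<^sub>C x = Re c *\<^sub>R x + Im c *\<^sub>R (\<i> *\<^sub>C x)" for x :: 'a
      unfolding scaleC_of_real[symmetric] scaleC_scaleC scaleC_add_left[symmetric]
      by (simp add: complex_eq[symmetric] mult.commute)
    have "(\<lambda>n. c *\<^sub>C s n) \<longlonglongrightarrow> c *\<^sub>C u"
      unfolding e by (intro tendsto_intros bounded_linear.tendsto[OF i] s)
    then show ?thesis unfolding closure_sequential
      by (intro exI[of _ "\<lambda>n. c *\<^sub>C s n"] conjI allI csubspaceD(3)[OF assms s(1)])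
  qed
  show ?thesis unfolding csubspace_def using 1 2 csubspaceD(1)[OF assms] closure_subset[of S] by blast
qed

lemma orth_decomposition:
  fixes S :: "'a::complex_hilbert set"
  assumes S: "csubspace S" and N: "N = {u. \<forall>s\<in>S. cinner u s = 0}"
  shows "orth_proj (closure S) u + orth_proj N u = u" "csubspace N"
proof -
  let ?M = "closure S"
  have Ms: "csubspace ?M" by (rule csubspace_closure[OF S])
  note P = orth_proj[OF Ms closed_closure]
  show Ns: "csubspace N" by (auto simp: csubspace_def N cinner_add_left cinner_scaleC_left)
  have "orth_proj N u = u - orth_proj ?M u"
  proof (rule orth_projI[OF Ns])
    show "u - orth_proj ?M u \<in> N" using P(2) closure_subset[of S] by (auto simp: N)
    show "\<forall>n\<in>N. cinner (u - (u - orth_proj ?M u)) n = 0"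
    proof
      fix n assume n: "n \<in> N"
      have "S \<subseteq> {s. inner n s = 0}" using n by (auto simp: N simp flip: Re_cinner)
      moreover have "closed {s. inner n s = 0}" by (intro closed_Collect_eq continuous_intros)
      ultimately have "?M \<subseteq> {s. inner n s = 0}" by (rule closure_minimal)
      then have "cinner n (orth_proj ?M u) = 0" using orth_real_imp[OF Ms] P(1) by blast
      then show "cinner (u - (u - orth_proj ?M u)) n = 0" by (metis cinner_commute complex_cnj_zero diff_diff_eq2 add_diff_cancel_left')
    qed
  qed
  then show "orth_proj ?M u + orth_proj N u = u" by simp
qed

context
  fixes A :: "'h::complex_hilbert \<Rightarrow> 'k::complex_hilbert"
  assumes A: "A \<in> bounded_ops UNIV UNIV"
begin

lemma cadjoint_cinner: "cinner (A m) v = cinner m (cadjoint A v)"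
  using adjoint_on[OF _ _ A] by (auto simp: csubspace_def)

lemma cinner_eqI: "(\<And>m. cinner m u = cinner m v) \<Longrightarrow> u = v" for u v :: "'a::complex_inner"
  by (metis cinner_diff_right cinner_self_0 right_minus_eq)

lemma cadjoint_linear: "cadjoint A (u + v) = cadjoint A u + cadjoint A v" "cadjoint A (c *\<^sub>C u) = c *\<^sub>C cadjoint A u"
  by (rule cinner_eqI; simp add: cinner_add_right cinner_scaleC_right flip: cadjoint_cinner)+

lemma operator_linear: "A (u + v) = A u + A v" "A (c *\<^sub>C u) = c *\<^sub>C A u"
  using A by (auto simp: bounded_ops_def)

lemma csubspace_range: "csubspace (range A)" "csubspace (range (cadjoint A))"
  unfolding csubspace_def
  by (auto simp flip: operator_linear cadjoint_linear) (metis operator_linear(2) cadjoint_linear(2) rangeI scaleC_of_real of_real_0 scaleR_zero_left)+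

lemma nullspace_eq_orthogonal: "nullspace A = {u. \<forall>s\<in>range (cadjoint A). cinner u s = 0}"
  "nullspace (cadjoint A) = {u. \<forall>s\<in>range A. cinner u s = 0}"
proof -
  show "nullspace A = {u. \<forall>s\<in>range (cadjoint A). cinner u s = 0}"
    by (auto simp: nullspace_def simp flip: cadjoint_cinner) (metis cinner_self_0)
  have "cinner u (A s) = cnj (cinner s (cadjoint A u))" for u s
    by (metis cadjoint_cinner cinner_commute)
  then show "nullspace (cadjoint A) = {u. \<forall>s\<in>range A. cinner u s = 0}"
    by (auto simp: nullspace_def) (metis cinner_self_0)
qed

text \<open>
  The representations \<open>A = (a 0; 0 0)\<close> and \<open>B = (b11 b12; b21 b22)\<close> relative to
  \<open>closure (R(A*)) \<oplus> N(A)\<close> and \<open>closure (R(A)) \<oplus> N(A*)\<close>.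
\<close>

lemma operator_matrix_representation:
  defines "H1 \<equiv> closure (range (cadjoint A))" and "H2 \<equiv> nullspace A"
    and "K1 \<equiv> closure (range A)" and "K2 \<equiv> nullspace (cadjoint A)"
  shows "A = block_op H1 H2 (block_entry K1 A) (\<lambda>_. 0) (\<lambda>_. 0) (\<lambda>_. 0)"
    and "B \<in> bounded_ops UNIV UNIV \<Longrightarrow>
     B = block_op H1 H2 (block_entry K1 B) (block_entry K1 B) (block_entry K2 B) (block_entry K2 B)"
proof -
  have dH: "orth_proj H1 u + orth_proj H2 u = u" for u
    unfolding H1_def H2_def using orth_decomposition csubspace_range nullspace_eq_orthogonal by blast
  have dK: "orth_proj K1 u + orth_proj K2 u = u" for u
    unfolding K1_def K2_def using orth_decomposition csubspace_range nullspace_eq_orthogonal by blast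
  have cs: "csubspace K1" "csubspace H2" using csubspace_closure csubspace_range K1_def H2_def orth_decomposition(2)[OF csubspace_range(2) nullspace_eq_orthogonal(1)] by auto
  show "A = block_op H1 H2 (block_entry K1 A) (\<lambda>_. 0) (\<lambda>_. 0) (\<lambda>_. 0)"
  proof
    fix u
    have cl: "closed H2"
    proof -
      obtain K where K: "\<And>x. norm (A x) \<le> K * norm x" using A by (auto simp: bounded_ops_def)
      have "bounded_linear A"
        by (rule bounded_linear_intro[where K=K])
           (auto simp: operator_linear K mult.commute simp flip: scaleC_of_real)
      then show ?thesis unfolding H2_def nullspace_def
        by (intro closed_Collect_eq continuous_intros linear_continuous_on) auto
    qed
    have "orth_proj H2 u \<in> H2" using orth_proj(1)[OF cs(2) cl] .
    then have "A (orth_proj H1 u) = A u" using dH[of u] operator_linear(1)[of "orth_proj H1 u" "orth_proj H2 u"]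
      by (simp add: H2_def nullspace_def)
    moreover have "orth_proj K1 (A u) = A u"
      using closure_subset[of "range A"] by (intro orth_projI cs) (auto simp: K1_def)
    ultimately show "A u = block_op H1 H2 (block_entry K1 A) (\<lambda>_. 0) (\<lambda>_. 0) (\<lambda>_. 0) u"
      by (simp add: block_op_def block_entry_def)
  qed
  assume B: "B \<in> bounded_ops UNIV UNIV"
  show "B = block_op H1 H2 (block_entry K1 B) (block_entry K1 B) (block_entry K2 B) (block_entry K2 B)"
  proof
    fix u
    let ?p = "orth_proj H1 u" and ?q = "orth_proj H2 u"
    have "B u = B ?p + B ?q" using B dH[of u] by (auto simp: bounded_ops_def) metis
    also have "\<dots> = (orth_proj K1 (B ?p) + orth_proj K2 (B ?p)) + (orth_proj K1 (B ?q) + orth_proj K2 (B ?q))"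
      by (simp add: dK)
    finally show "B u = block_op H1 H2 (block_entry K1 B) (block_entry K1 B) (block_entry K2 B) (block_entry K2 B) u"
      by (simp add: block_op_def block_entry_def ac_simps)
  qed
qed

end

end

theory Submission
  imports Defs
begin

text \<open>
  Every pair of projections with \<open>A = Qt B Q\<close> can be replaced by the pair \<open>P Qt\<close>, \<open>Q E\<close>, where \<open>P\<close> and
  \<open>E\<close> are the orthogonal projections onto \<open>closure (R(A))\<close> and \<open>closure (R(A*))\<close>. These have the
  matrices \<open>(1 -y; 0 0)\<close> and \<open>(1 0; -x 0)\<close>, and then \<open>A = Qt B Q\<close> solved for \<open>b11\<close> is exactly the
  representation of \<open>B\<close>, with \<open>w = b21 - b22 x\<close> and \<open>z = b12 - y b22\<close>. The two
  correction matrices are \<open>(I - Qt) B Q\<close> and \<open>Qt B (I - Q)\<close>. Finally \<open>(I - Qt) B Q = B Q - A\<close>, so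
  that its range lies in \<open>R(B)\<close> if and only if that of \<open>A\<close> does, and dually for the adjoints.
\<close>

subsection \<open>Bounded operators between subspaces\<close>

lemma bounded_opsI:
  assumes "\<And>u. u \<in> M \<Longrightarrow> T u \<in> N"
    and "\<And>u v. u \<in> M \<Longrightarrow> v \<in> M \<Longrightarrow> T (u + v) = T u + T v"
    and "\<And>c u. u \<in> M \<Longrightarrow> T (c *\<^sub>C u) = c *\<^sub>C T u"
    and "\<And>u. u \<in> M \<Longrightarrow> norm (T u) \<le> K * norm u"
  shows "T \<in> bounded_ops M N"
  using assms unfolding bounded_ops_def by blast

lemma bounded_opsD:
  assumes "T \<in> bounded_ops M N"
  shows "u \<in> M \<Longrightarrow> T u \<in> N"
    and "u \<in> M \<Longrightarrow> v \<in> M \<Longrightarrow> T (u + v) = T u + T v"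
    and "u \<in> M \<Longrightarrow> T (c *\<^sub>C u) = c *\<^sub>C T u"
  using assms unfolding bounded_ops_def by blast+

text \<open>Passing to the absolute value makes the constant nonnegative, so that bounds can be
  multiplied when operators are composed.\<close>

lemma bounded_ops_bound:
  assumes "T \<in> bounded_ops M N"
  obtains K where "K \<ge> 0" "\<And>u. u \<in> M \<Longrightarrow> norm (T u) \<le> K * norm u"
proof -
  obtain K where K: "\<And>u. u \<in> M \<Longrightarrow> norm (T u) \<le> K * norm u"
    using assms unfolding bounded_ops_def by blast
  have "norm (T u) \<le> \<bar>K\<bar> * norm u" if "u \<in> M" for u
    using K[OF that] mult_right_mono[OF abs_ge_self norm_ge_zero] by (rule order_trans)
  then show thesis using that[of "\<bar>K\<bar>"] by simp
qed

lemma scaleC_minus_right: "c *\<^sub>C (- x) = - (c *\<^sub>C x)" for x :: "'a::complex_inner"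
  using scaleC_scaleC[of c "-1" x] scaleC_scaleC[of "-1" c x] by (simp add: scaleC_m1)

lemma scaleC_diff_right: "c *\<^sub>C (x - y) = c *\<^sub>C x - c *\<^sub>C y" for x :: "'a::complex_inner"
  using scaleC_add_right[of c x "- y"] by (simp add: scaleC_minus_right)

lemma csubspace_UNIV: "csubspace UNIV"
  by (simp add: csubspace_def)

lemma csubspace_uminus: "csubspace M \<Longrightarrow> u \<in> M \<Longrightarrow> - u \<in> M"
  using csubspaceD(1)[of M] csubspaceD(5)[of M 0 u] by auto

lemma csubspace_diff_iff: "csubspace M \<Longrightarrow> u \<in> M \<Longrightarrow> u - v \<in> M \<longleftrightarrow> v \<in> M"
  using csubspaceD(5)[of M u v] csubspaceD(5)[of M u "u - v"] by auto

lemma bounded_ops_minus_arg: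
  assumes "T \<in> bounded_ops M N" "u \<in> M"
  shows "T (- u) = - T u"
  using bounded_opsD(3)[OF assms, of "-1"] by (simp add: scaleC_m1)

lemma bounded_ops_zero_arg:
  assumes "T \<in> bounded_ops M N" "csubspace M"
  shows "T 0 = 0"
  using bounded_opsD(2)[OF assms(1), of 0 0] csubspaceD(1)[OF assms(2)] by simp

lemma bounded_ops_diff_arg:
  assumes "T \<in> bounded_ops M N" "csubspace M" "u \<in> M" "v \<in> M"
  shows "T (u - v) = T u - T v"
  using bounded_opsD(2)[OF assms(1), of "u - v" v] csubspaceD(5)[OF assms(2)] assms by simp

lemma bounded_ops_id: "M \<subseteq> N \<Longrightarrow> (\<lambda>u. u) \<in> bounded_ops M N"
  by (rule bounded_opsI[where K = 1]) auto

lemma bounded_ops_compose: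
  assumes T: "T \<in> bounded_ops M N" and S: "S \<in> bounded_ops N L"
  shows "(\<lambda>u. S (T u)) \<in> bounded_ops M L"
proof -
  obtain K where K: "K \<ge> 0" "\<And>u. u \<in> M \<Longrightarrow> norm (T u) \<le> K * norm u"
    using bounded_ops_bound[OF T] by blast
  obtain J where J: "J \<ge> 0" "\<And>u. u \<in> N \<Longrightarrow> norm (S u) \<le> J * norm u"
    using bounded_ops_bound[OF S] by blast
  show ?thesis
  proof (rule bounded_opsI[where K = "J * K"])
    fix u assume u: "u \<in> M"
    have "norm (S (T u)) \<le> J * norm (T u)" using J(2) bounded_opsD(1)[OF T u] .
    also have "\<dots> \<le> J * (K * norm u)" using K(2)[OF u] J(1) by (rule mult_left_mono)
    finally show "norm (S (T u)) \<le> J * K * norm u" by (simp add: mult.assoc)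
  qed (simp_all add: bounded_opsD[OF T] bounded_opsD[OF S])
qed

lemma bounded_ops_diff:
  assumes N: "csubspace N" and T: "T \<in> bounded_ops M N" and S: "S \<in> bounded_ops M N"
  shows "(\<lambda>u. T u - S u) \<in> bounded_ops M N"
proof -
  obtain K where K: "K \<ge> 0" "\<And>u. u \<in> M \<Longrightarrow> norm (T u) \<le> K * norm u"
    using bounded_ops_bound[OF T] by blast
  obtain J where J: "J \<ge> 0" "\<And>u. u \<in> M \<Longrightarrow> norm (S u) \<le> J * norm u"
    using bounded_ops_bound[OF S] by blast
  show ?thesis
  proof (rule bounded_opsI[where K = "K + J"])
    fix u assume u: "u \<in> M"
    show "norm (T u - S u) \<le> (K + J) * norm u"
      using norm_triangle_ineq4[of "T u" "S u"] K(2)[OF u] J(2)[OF u] by (simp add: distrib_right)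
  qed (simp_all add: bounded_opsD[OF T] bounded_opsD[OF S] csubspaceD(5)[OF N] scaleC_diff_right)
qed

lemma bounded_ops_uminus:
  assumes N: "csubspace N" and T: "T \<in> bounded_ops M N"
  shows "(\<lambda>u. - T u) \<in> bounded_ops M N"
proof -
  obtain K where "\<And>u. u \<in> M \<Longrightarrow> norm (T u) \<le> K * norm u"
    using bounded_ops_bound[OF T] by blast
  then show ?thesis
    by (intro bounded_opsI[where K = K])
      (simp_all add: bounded_opsD[OF T] csubspace_uminus[OF N] scaleC_minus_right)
qed

lemma bounded_ops_subset:
  assumes "T \<in> bounded_ops M N" "M' \<subseteq> M" "N \<subseteq> N'"
  shows "T \<in> bounded_ops M' N'"
  using assms unfolding bounded_ops_def by blast

lemma bounded_ops_bounded_linear: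
  assumes T: "T \<in> bounded_ops UNIV N"
  shows "bounded_linear T"
proof -
  obtain K where K: "\<And>u. norm (T u) \<le> K * norm u"
    using bounded_ops_bound[OF T] by auto
  show ?thesis
  proof (rule bounded_linear_intro)
    show "norm (T u) \<le> norm u * K" for u using K[of u] by (simp add: mult.commute)
    show "T (r *\<^sub>R u) = r *\<^sub>R T u" for r u
      using bounded_opsD(3)[OF T, of u "complex_of_real r"] by (simp add: scaleC_of_real)
  qed (simp add: bounded_opsD(2)[OF T])
qed

text \<open>Testing against the difference \<open>cadjoint T v - u\<close> shows that this vector is
  orthogonal to itself. Adjoints are computed below by guessing \<open>u\<close>.\<close>

lemma cadjoint_eqI:
  fixes T :: "'a::complex_hilbert \<Rightarrow> 'b::complex_hilbert"
  assumes T: "T \<in> bounded_ops UNIV UNIV" and u: "\<And>m. cinner (T m) v = cinner m u"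
  shows "cadjoint T v = u"
proof -
  have "cinner (cadjoint T v - u) (cadjoint T v - u) = 0"
    using cadjoint_cinner[OF T, of "cadjoint T v - u" v] u[of "cadjoint T v - u"]
    by (simp add: cinner_diff_right)
  then show ?thesis by (simp add: cinner_self_0)
qed

subsection \<open>Orthogonal sums\<close>

text \<open>The single identity \<open>decomposition\<close> encodes both spanning and
  orthogonality: a vector of \<open>N\<close> is its own projection onto \<open>N\<close>, so its
  projection onto \<open>M\<close> vanishes.\<close>

locale orthogonal_sum =
  fixes M N :: "'a::complex_hilbert set"
  assumes M: "csubspace M" "closed M"
    and N: "csubspace N" "closed N"
    and decomposition: "orth_proj M u + orth_proj N u = u"
begin

lemma sum_commute: "orthogonal_sum N M"
  by unfold_locales (use M N decomposition in \<open>simp_all add: add.commute\<close>)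

lemma proj_mem [simp]: "orth_proj M u \<in> M" "orth_proj N u \<in> N"
  using orth_proj(1) M N by blast+

lemma proj_of_mem: "m \<in> M \<Longrightarrow> orth_proj M m = m"
  by (rule orth_projI[OF M(1)]) auto

lemma proj_of_mem_compl: "n \<in> N \<Longrightarrow> orth_proj M n = 0"
  using decomposition[of n] orth_projI[OF N(1), of n n] by simp

lemma orthogonal:
  assumes "m \<in> M" "n \<in> N"
  shows "cinner m n = 0" "cinner n m = 0"
proof -
  show "cinner n m = 0"
    using orth_proj(2)[OF M assms(1), of n] proj_of_mem_compl[OF assms(2)] by simp
  then show "cinner m n = 0" by (metis cinner_commute complex_cnj_zero)
qed

lemma proj_bounded_ops: "orth_proj M \<in> bounded_ops UNIV M"
proof (rule bounded_opsI[where K = 1])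
  show "orth_proj M (u + v) = orth_proj M u + orth_proj M v" for u v
  proof (rule orth_projI[OF M(1)])
    show "\<forall>n\<in>M. cinner (u + v - (orth_proj M u + orth_proj M v)) n = 0"
      using orth_proj(2)[OF M] cinner_add_left[of "u - orth_proj M u" "v - orth_proj M v"]
      by (simp add: add_diff_add)
  qed (intro csubspaceD(2)[OF M(1)] proj_mem)
  show "orth_proj M (c *\<^sub>C u) = c *\<^sub>C orth_proj M u" for c u
  proof (rule orth_projI[OF M(1)])
    show "\<forall>n\<in>M. cinner (c *\<^sub>C u - c *\<^sub>C orth_proj M u) n = 0"
      using orth_proj(2)[OF M] by (simp add: cinner_scaleC_left flip: scaleC_diff_right)
  qed (intro csubspaceD(3)[OF M(1)] proj_mem)
  show "norm (orth_proj M u) \<le> 1 * norm u" for u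
  proof -
    let ?p = "orth_proj M u"
    \<comment> \<open>The residual is orthogonal to \<open>?p\<close>, so the square of
      \<open>norm ?p\<close> equals \<open>inner u ?p\<close>, and Cauchy-Schwarz applies.\<close>
    have "inner (u - ?p) ?p = 0" using orth_proj(2)[OF M, of ?p u] by (simp flip: Re_cinner)
    then have "norm ?p * norm ?p \<le> norm u * norm ?p"
      using Cauchy_Schwarz_ineq2[of u ?p] dot_square_norm[of ?p]
      by (simp add: inner_diff_left power2_eq_square)
    then show ?thesis by (cases "?p = 0") auto
  qed
qed simp

lemmas proj_linear = bounded_opsD(2,3)[OF proj_bounded_ops, simplified]
  bounded_ops_diff_arg[OF proj_bounded_ops csubspace_UNIV, simplified]

text \<open>For \<open>y\<close> from \<open>N\<close> to \<open>M\<close> this is the projection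
  onto \<open>M\<close> along the graph of all \<open>y n + n\<close> with \<open>n\<close> in
  \<open>N\<close>.\<close>

definition oblique_onto :: "('a \<Rightarrow> 'a) \<Rightarrow> 'a \<Rightarrow> 'a" where
  "oblique_onto y v = orth_proj M v - y (orth_proj N v)"

text \<open>For \<open>x\<close> from \<open>M\<close> to \<open>N\<close> this is the projection
  along \<open>N\<close> onto the graph of all \<open>m - x m\<close> with \<open>m\<close> in
  \<open>M\<close>.\<close>

definition oblique_along :: "('a \<Rightarrow> 'a) \<Rightarrow> 'a \<Rightarrow> 'a" where
  "oblique_along x u = orth_proj M u - x (orth_proj M u)"

text \<open>Idempotent because it takes values in \<open>M\<close> and fixes every vector of
  \<open>M\<close>.\<close>

lemma projection_oblique_onto:
  assumes y: "y \<in> bounded_ops N M"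
  shows "projection_op (oblique_onto y)"
proof -
  interpret c: orthogonal_sum N M by (rule sum_commute)
  have "oblique_onto y \<in> bounded_ops UNIV M"
    unfolding oblique_onto_def
    by (intro bounded_ops_diff M(1) proj_bounded_ops bounded_ops_compose[OF c.proj_bounded_ops y])
  moreover have "oblique_onto y v = v" if "v \<in> M" for v
    using that by (simp add: oblique_onto_def proj_of_mem c.proj_of_mem_compl
        bounded_ops_zero_arg[OF y N(1)])
  ultimately show ?thesis
    unfolding projection_op_def
    by (auto simp: fun_eq_iff intro: bounded_ops_subset bounded_opsD(1))
qed

text \<open>Idempotent because it depends only on the component in \<open>M\<close> and leaves that
  component unchanged.\<close>

lemma projection_oblique_along:
  assumes x: "x \<in> bounded_ops M N"
  shows "projection_op (oblique_along x)"
proof -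
  have "x \<in> bounded_ops M UNIV" using bounded_ops_subset[OF x] by blast
  then have "oblique_along x \<in> bounded_ops UNIV UNIV"
    unfolding oblique_along_def
    by (intro bounded_ops_diff csubspace_UNIV bounded_ops_compose[OF proj_bounded_ops]
        bounded_ops_subset[OF proj_bounded_ops]) auto
  moreover have "orth_proj M (oblique_along x u) = orth_proj M u" for u
    using bounded_opsD(1)[OF x]
    by (simp add: oblique_along_def proj_linear proj_of_mem proj_of_mem_compl)
  ultimately show ?thesis
    unfolding projection_op_def by (auto simp: oblique_along_def)
qed

text \<open>Since \<open>Q\<close> fixes \<open>M\<close>, following it by the orthogonal projection
  onto \<open>M\<close> gives the identity on \<open>M\<close>; on \<open>N\<close> the result is
  the entry \<open>-y\<close>.\<close>

lemma oblique_onto_of_projection: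
  assumes Q: "Q \<in> bounded_ops UNIV UNIV" and fixed: "\<And>m. m \<in> M \<Longrightarrow> Q m = m"
  shows "(\<lambda>k. - orth_proj M (Q k)) \<in> bounded_ops N M"
    and "oblique_onto (\<lambda>k. - orth_proj M (Q k)) v = orth_proj M (Q v)"
proof -
  show "(\<lambda>k. - orth_proj M (Q k)) \<in> bounded_ops N M"
    by (intro bounded_ops_uminus M(1) bounded_ops_compose[OF _ proj_bounded_ops]
        bounded_ops_subset[OF Q]) auto
  have "Q v = orth_proj M v + Q (orth_proj N v)"
    using bounded_opsD(2)[OF Q, of "orth_proj M v" "orth_proj N v"]
    by (simp add: decomposition fixed)
  then show "oblique_onto (\<lambda>k. - orth_proj M (Q k)) v = orth_proj M (Q v)"
    by (simp add: oblique_onto_def proj_linear proj_of_mem)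
qed

text \<open>Dual to the previous lemma: \<open>Q\<close> changes vectors only by elements of
  \<open>N\<close>, so its restriction to \<open>M\<close> has first entry the identity, and its
  second entry is \<open>-x\<close>.\<close>

lemma oblique_along_of_projection:
  assumes Q: "Q \<in> bounded_ops UNIV UNIV" and ker: "\<And>u. Q u - u \<in> N"
  shows "(\<lambda>h. - orth_proj N (Q h)) \<in> bounded_ops M N"
    and "oblique_along (\<lambda>h. - orth_proj N (Q h)) u = Q (orth_proj M u)"
proof -
  interpret c: orthogonal_sum N M by (rule sum_commute)
  show "(\<lambda>h. - orth_proj N (Q h)) \<in> bounded_ops M N"
    by (intro bounded_ops_uminus N(1) bounded_ops_compose[OF _ c.proj_bounded_ops]
        bounded_ops_subset[OF Q]) auto
  have "orth_proj M (Q (orth_proj M u) - orth_proj M u) = 0"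
    using ker by (rule proj_of_mem_compl)
  then have "orth_proj M (Q (orth_proj M u)) = orth_proj M u"
    by (simp add: proj_linear proj_of_mem)
  then show "oblique_along (\<lambda>h. - orth_proj N (Q h)) u = Q (orth_proj M u)"
    using decomposition[of "Q (orth_proj M u)"] by (simp add: oblique_along_def)
qed

end

section \<open>Closures of ranges and nullspaces as orthogonal summands\<close>

lemma orthogonal_sum_closure:
  fixes S :: "'a::complex_hilbert set"
  assumes S: "csubspace S" and N: "N = {u. \<forall>s\<in>S. cinner u s = 0}"
  shows "orthogonal_sum (closure S) N"
proof
  \<comment> \<open>Complex orthogonality amounts to two real orthogonality conditions, each closed
    in \<open>u\<close>; hence \<open>N\<close> is an intersection of closed sets.\<close>
  have "cinner u s = 0 \<longleftrightarrow> inner u s = 0 \<and> inner u (\<i> *\<^sub>C s) = 0" for u s :: 'a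
    by (simp add: complex_eq_iff cinner_scaleC_right flip: Re_cinner)
  then have "N = (\<Inter>s\<in>S. {u. inner u s = 0} \<inter> {u. inner u (\<i> *\<^sub>C s) = 0})"
    by (auto simp: N)
  moreover have "closed {u. inner u s = 0}" for s :: 'a
    by (intro closed_Collect_eq continuous_intros)
  ultimately show "closed N" by (auto intro: closed_INT)
qed (use csubspace_closure[OF S] orth_decomposition[OF S N] in auto)

lemma orthogonal_sum_operator:
  fixes A :: "'h::complex_hilbert \<Rightarrow> 'k::complex_hilbert"
  assumes A: "A \<in> bounded_ops UNIV UNIV"
  shows "orthogonal_sum (closure (range (cadjoint A))) (nullspace A)"
    and "orthogonal_sum (closure (range A)) (nullspace (cadjoint A))"
  using orthogonal_sum_closure csubspace_range[OF A] nullspace_eq_orthogonal[OF A] by blast+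

text \<open>The other component of \<open>u\<close> lies in the nullspace of
  \<open>A\<close>.\<close>

lemma operator_orth_proj:
  fixes A :: "'h::complex_hilbert \<Rightarrow> 'k::complex_hilbert"
  assumes A: "A \<in> bounded_ops UNIV UNIV"
  shows "A (orth_proj (closure (range (cadjoint A))) u) = A u"
proof -
  interpret orthogonal_sum "closure (range (cadjoint A))" "nullspace A"
    using A by (rule orthogonal_sum_operator)
  have "A (orth_proj (nullspace A) u) = 0"
    using proj_mem(2)[of u] by (simp add: nullspace_def)
  then show ?thesis
    using bounded_opsD(2)[OF A, of "orth_proj (closure (range (cadjoint A))) u"
        "orth_proj (nullspace A) u"]
    by (simp add: decomposition)
qed

subsection \<open>The range conditions\<close>

text \<open>Modulo \<open>S\<close> the difference of \<open>f\<close> and \<open>g\<close> is just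
  \<open>- g\<close>.\<close>

lemma range_diff_subset_iff:
  assumes "csubspace S" "\<And>u. f u \<in> S"
  shows "range (\<lambda>u. f u - g u) \<subseteq> S \<longleftrightarrow> range g \<subseteq> S"
  using csubspace_diff_iff[OF assms(1)] assms(2) by (simp add: image_subset_iff)

lemma range_condition_iff:
  fixes B :: "'h::complex_hilbert \<Rightarrow> 'k::complex_hilbert"
  assumes B: "B \<in> bounded_ops UNIV UNIV" and A: "A = Qt \<circ> B \<circ> Q"
  shows "range (\<lambda>u. B (Q u) - Qt (B (Q u))) \<subseteq> range B \<longleftrightarrow> range A \<subseteq> range B"
  using range_diff_subset_iff[OF csubspace_range(1)[OF B], of "\<lambda>u. B (Q u)" A]
  by (simp add: A comp_def)

text \<open>The operator \<open>Qt B (I - Q)\<close> equals \<open>Qt B - A\<close>. Its adjoint is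
  the adjoint of \<open>Qt\<close> followed by that of \<open>B\<close>, minus the adjoint of
  \<open>A\<close>; the first term has values in the range of \<open>cadjoint B\<close>.\<close>

lemma adjoint_range_condition_iff:
  fixes A B :: "'h::complex_hilbert \<Rightarrow> 'k::complex_hilbert"
  assumes B: "B \<in> bounded_ops UNIV UNIV" and Aop: "A \<in> bounded_ops UNIV UNIV"
    and A: "A = Qt \<circ> B \<circ> Q"
    and Qt: "Qt \<in> bounded_ops UNIV UNIV" and Q: "Q \<in> bounded_ops UNIV UNIV"
  shows "range (cadjoint (\<lambda>u. Qt (B (u - Q u)))) \<subseteq> range (cadjoint B)
    \<longleftrightarrow> range (cadjoint A) \<subseteq> range (cadjoint B)"
proof -
  have "(\<lambda>u. Qt (B (u - Q u))) \<in> bounded_ops UNIV UNIV"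
    by (rule bounded_ops_compose[OF bounded_ops_compose[OF bounded_ops_diff[OF csubspace_UNIV
              bounded_ops_id[OF order_refl] Q] B] Qt])
  moreover have "Qt (B (u - Q u)) = Qt (B u) - A u" for u
    by (simp add: A bounded_ops_diff_arg[OF B csubspace_UNIV]
        bounded_ops_diff_arg[OF Qt csubspace_UNIV])
  ultimately have "cadjoint (\<lambda>u. Qt (B (u - Q u))) v = cadjoint B (cadjoint Qt v) - cadjoint A v"
    for v
    by (intro cadjoint_eqI)
      (simp_all add: cinner_diff_left cinner_diff_right cadjoint_cinner[OF B]
        cadjoint_cinner[OF Qt] cadjoint_cinner[OF Aop])
  then show ?thesis
    using range_diff_subset_iff[OF csubspace_range(2)[OF B], of "\<lambda>v. cadjoint B (cadjoint Qt v)"]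
    by simp
qed

text \<open>The two sets of range conditions are equivalent for each fixed pair of projections, so
  the same pair is a witness in both directions.\<close>

lemma plus_le_iff_range_conditions:
  fixes A B :: "'h::complex_hilbert \<Rightarrow> 'k::complex_hilbert"
  assumes A: "A \<in> bounded_ops UNIV UNIV" and B: "B \<in> bounded_ops UNIV UNIV"
  shows "plus_le A B \<longleftrightarrow>
    (\<exists>Qt Q. projection_op Qt \<and> projection_op Q \<and> A = Qt \<circ> B \<circ> Q \<and>
      range (\<lambda>u. B (Q u) - Qt (B (Q u))) \<subseteq> range B \<and>
      range (cadjoint (\<lambda>u. Qt (B (u - Q u)))) \<subseteq> range (cadjoint B))"
    (is "_ \<longleftrightarrow> ?rhs")
proof -
  have key: "range (\<lambda>u. B (Q u) - Qt (B (Q u))) \<subseteq> range B \<and>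
      range (cadjoint (\<lambda>u. Qt (B (u - Q u)))) \<subseteq> range (cadjoint B) \<longleftrightarrow>
      range A \<subseteq> range B \<and> range (cadjoint A) \<subseteq> range (cadjoint B)"
    if "projection_op Qt" "projection_op Q" "A = Qt \<circ> B \<circ> Q" for Qt Q
    using range_condition_iff[OF B that(3)] adjoint_range_condition_iff[OF B A that(3)] that(1,2)
    unfolding projection_op_def by blast
  show ?thesis
  proof
    assume "plus_le A B"
    then obtain Qt Q where Q: "projection_op Qt" "projection_op Q" "A = Qt \<circ> B \<circ> Q"
      and "range A \<subseteq> range B \<and> range (cadjoint A) \<subseteq> range (cadjoint B)"
      unfolding plus_le_def by blast
    from Q iffD2[OF key[OF Q] this(4)] show ?rhs by blast
  next
    assume ?rhs
    then obtain Qt Q where Q: "projection_op Qt" "projection_op Q" "A = Qt \<circ> B \<circ> Q"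
      and "range (\<lambda>u. B (Q u) - Qt (B (Q u))) \<subseteq> range B \<and>
        range (cadjoint (\<lambda>u. Qt (B (u - Q u)))) \<subseteq> range (cadjoint B)"
      by blast
    from Q iffD1[OF key[OF Q] this(4)] show "plus_le A B" unfolding plus_le_def by blast
  qed
qed

text \<open>Normal form of the projections: one onto \<open>K1\<close>, the other along
  \<open>H2\<close>. Such pairs are parametrized by \<open>y\<close> and \<open>x\<close>, the
  parameters of the matrix representation.\<close>

lemma plus_le_iff_oblique:
  fixes A B :: "'h::complex_hilbert \<Rightarrow> 'k::complex_hilbert"
  assumes A: "A \<in> bounded_ops UNIV UNIV" and B: "B \<in> bounded_ops UNIV UNIV"
  defines "H1 \<equiv> closure (range (cadjoint A))" and "H2 \<equiv> nullspace A"
    and "K1 \<equiv> closure (range A)" and "K2 \<equiv> nullspace (cadjoint A)"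
  defines "Qt \<equiv> orthogonal_sum.oblique_onto K1 K2" and "Q \<equiv> orthogonal_sum.oblique_along H1"
  shows "plus_le A B \<longleftrightarrow>
    (\<exists>y \<in> bounded_ops K2 K1. \<exists>x \<in> bounded_ops H1 H2. A = Qt y \<circ> B \<circ> Q x \<and>
      range (\<lambda>u. B (Q x u) - Qt y (B (Q x u))) \<subseteq> range B \<and>
      range (cadjoint (\<lambda>u. Qt y (B (u - Q x u)))) \<subseteq> range (cadjoint B))"
    (is "_ \<longleftrightarrow> ?oblique")
proof
  interpret h: orthogonal_sum H1 H2
    unfolding H1_def H2_def using A by (rule orthogonal_sum_operator)
  interpret k: orthogonal_sum K1 K2
    unfolding K1_def K2_def using A by (rule orthogonal_sum_operator)
  have proj: "projection_op (Qt y)" "projection_op (Q x)"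
    if "y \<in> bounded_ops K2 K1" "x \<in> bounded_ops H1 H2" for x y
    using k.projection_oblique_onto h.projection_oblique_along that unfolding Qt_def Q_def by auto
  show "?oblique \<Longrightarrow> plus_le A B"
    unfolding plus_le_iff_range_conditions[OF A B] using proj by blast
  assume "plus_le A B"
  then obtain Qt0 Q0 where Q0: "projection_op Qt0" "projection_op Q0" "A = Qt0 \<circ> B \<circ> Q0"
    and ranges: "range A \<subseteq> range B" "range (cadjoint A) \<subseteq> range (cadjoint B)"
    unfolding plus_le_def by blast
  have Qt0: "Qt0 \<in> bounded_ops UNIV UNIV" "Qt0 (Qt0 v) = Qt0 v" for v
    using Q0(1) by (auto simp: projection_op_def fun_eq_iff)
  have Q0': "Q0 \<in> bounded_ops UNIV UNIV" "Q0 (Q0 u) = Q0 u" for u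
    using Q0(2) by (auto simp: projection_op_def fun_eq_iff)
  \<comment> \<open>The range of \<open>A\<close> lies in that of the idempotent \<open>Qt0\<close>,
    and the fixed points of \<open>Qt0\<close> form a closed set.\<close>
  have fixed: "Qt0 m = m" if "m \<in> K1" for m
  proof -
    have "closed {m. Qt0 m = m}"
      by (intro closed_Collect_eq continuous_intros
          linear_continuous_on[OF bounded_ops_bounded_linear[OF Qt0(1)]])
    moreover have "range A \<subseteq> {m. Qt0 m = m}" using Qt0(2) by (auto simp: Q0(3))
    ultimately show ?thesis using that closure_minimal unfolding K1_def by blast
  qed
  \<comment> \<open>From \<open>A = Qt0 B Q0\<close> and idempotence,
    \<open>A (Q0 u) = A u\<close>.\<close>
  have ker: "Q0 u - u \<in> H2" for u
    by (simp add: H2_def nullspace_def bounded_ops_diff_arg[OF A csubspace_UNIV])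
      (simp add: Q0(3) Q0')
  define y where "y = (\<lambda>v. - orth_proj K1 (Qt0 v))"
  define x where "x = (\<lambda>h. - orth_proj H2 (Q0 h))"
  note y = k.oblique_onto_of_projection[OF Qt0(1) fixed, folded y_def]
  note x = h.oblique_along_of_projection[OF Q0'(1) ker, folded x_def]
  have A1: "A (orth_proj H1 u) = A u" for u
    unfolding H1_def using A by (rule operator_orth_proj)
  have "A u \<in> K1" for u using closure_subset[of "range A"] by (auto simp: K1_def)
  \<comment> \<open>The new pair is \<open>Qt0\<close> followed by the projection onto
    \<open>K1\<close>, and \<open>Q0\<close> preceded by the projection onto \<open>H1\<close>;
    neither compression changes \<open>A\<close>.\<close>
  then have "Qt y (B (Q x u)) = A u" for u
    using A1[of u] by (simp add: Qt_def Q_def y x k.proj_of_mem Q0(3))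
  then have eq: "A = Qt y \<circ> B \<circ> Q x" by (simp add: fun_eq_iff)
  have "Qt y \<in> bounded_ops UNIV UNIV" "Q x \<in> bounded_ops UNIV UNIV"
    using proj[OF y(1) x(1)] by (simp_all add: projection_op_def)
  \<comment> \<open>The range inclusions for \<open>A\<close> do not mention the projections, so
    they yield the range conditions for the new pair.\<close>
  then show ?oblique
    using y(1) x(1) eq ranges range_condition_iff[OF B eq] adjoint_range_condition_iff[OF B A eq]
    by blast
qed

subsection \<open>The matrix representation\<close>

text \<open>By \<open>T_eq\<close> the matrix of \<open>T\<close> is \<open>(z x z; 0 0)\<close>.
  Factoring through \<open>H2\<close> lets the adjoint of \<open>z\<close> be taken first, and then
  that of \<open>x\<close>.\<close>

lemma adjoint_block_op:
  fixes x :: "'h::complex_hilbert \<Rightarrow> 'h" and z :: "'h \<Rightarrow> 'k::complex_hilbert"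
  assumes "orthogonal_sum H1 H2" "orthogonal_sum K1 K2"
    and T: "T \<in> bounded_ops UNIV UNIV"
    and x: "x \<in> bounded_ops H1 H2" and z: "z \<in> bounded_ops H2 K1"
    and T_eq: "\<And>u. T u = z (x (orth_proj H1 u) + orth_proj H2 u)"
  shows "block_op K1 K2 (\<lambda>k. adjoint_on H1 x (adjoint_on H2 z k)) (\<lambda>_. 0) (adjoint_on H2 z) (\<lambda>_. 0)
    = cadjoint T"
proof
  interpret h: orthogonal_sum H1 H2 by fact
  interpret k: orthogonal_sum K1 K2 by fact
  fix v
  let ?p = "orth_proj K1 v"
  let ?q = "adjoint_on H2 z ?p"
  let ?r = "adjoint_on H1 x ?q"
  have q: "?q \<in> H2" "cinner (z m) ?p = cinner m ?q" if "m \<in> H2" for m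
    using adjoint_on[OF h.N z] that by blast+
  have r: "?r \<in> H1" "cinner (x m) ?q = cinner m ?r" if "m \<in> H1" for m
    using adjoint_on[OF h.M x] that by blast+
  have "cinner (T m) v = cinner m (?r + ?q)" for m
  proof -
    let ?m1 = "orth_proj H1 m" and ?m2 = "orth_proj H2 m"
    have xm: "x ?m1 + ?m2 \<in> H2"
      using csubspaceD(2)[OF h.N(1)] bounded_opsD(1)[OF x] by simp
    have "cinner (T m) v = cinner (T m) ?p + cinner (T m) (orth_proj K2 v)"
      by (simp add: k.decomposition flip: cinner_add_right)
    \<comment> \<open>\<open>T\<close> takes values in \<open>K1\<close>, so the component of
      \<open>v\<close> in \<open>K2\<close> contributes nothing.\<close>
    also have "\<dots> = cinner (z (x ?m1 + ?m2)) ?p"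
      using k.orthogonal(1)[OF bounded_opsD(1)[OF z xm]] by (simp add: T_eq)
    also have "\<dots> = cinner ?m1 ?r + cinner ?m2 ?q"
      using q(2)[OF xm] r(2)[of ?m1] by (simp add: cinner_add_left)
    also have "\<dots> = cinner (?m1 + ?m2) (?r + ?q)"
      using h.orthogonal q(1)[OF csubspaceD(1)[OF h.N(1)]] r(1)[OF csubspaceD(1)[OF h.M(1)]]
      by (simp add: cinner_add_left cinner_add_right)
    finally show ?thesis by (simp add: h.decomposition)
  qed
  then have "cadjoint T v = ?r + ?q" by (rule cadjoint_eqI[OF T])
  then show "block_op K1 K2 (\<lambda>k. adjoint_on H1 x (adjoint_on H2 z k)) (\<lambda>_. 0)
      (adjoint_on H2 z) (\<lambda>_. 0) v = cadjoint T v"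
    by (simp add: block_op_def)
qed

text \<open>The matrix sum is \<open>A u + z (x p + q)\<close> plus a graph vector
  \<open>y s + s\<close>, where \<open>p\<close>, \<open>q\<close> are the components of
  \<open>u\<close> and \<open>s\<close> is the second row. \<open>Qt\<close> annihilates the graph
  vector, which isolates the remaining terms and determines \<open>w\<close> and \<open>z\<close> on
  their domains.\<close>

lemma block_representation_iff:
  fixes A B :: "'h::complex_hilbert \<Rightarrow> 'k::complex_hilbert"
  assumes H: "orthogonal_sum H1 H2" and K: "orthogonal_sum K1 K2"
    and A: "A \<in> bounded_ops UNIV UNIV" and B: "B \<in> bounded_ops UNIV UNIV"
    and AK: "\<And>u. A u \<in> K1" and AH: "\<And>u. A (orth_proj H1 u) = A u"
    and y: "y \<in> bounded_ops K2 K1" and x: "x \<in> bounded_ops H1 H2"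
    and w: "w \<in> bounded_ops H1 K2" and z: "z \<in> bounded_ops H2 K1"
  defines "a \<equiv> block_entry K1 A" and "b22 \<equiv> block_entry K2 B"
    and "Qt \<equiv> orthogonal_sum.oblique_onto K1 K2 y" and "Q \<equiv> orthogonal_sum.oblique_along H1 x"
  shows "B = (\<lambda>u. block_op H1 H2 (\<lambda>h. a h + y (b22 (x h))) (\<lambda>h. y (b22 h)) (\<lambda>h. b22 (x h)) b22 u
              + block_op H1 H2 (\<lambda>h. y (w h)) (\<lambda>_. 0) w (\<lambda>_. 0) u
              + block_op H1 H2 (\<lambda>h. z (x h)) z (\<lambda>_. 0) (\<lambda>_. 0) u)
    \<longleftrightarrow> A = Qt \<circ> B \<circ> Q \<and> (\<forall>h\<in>H1. w h = orth_proj K2 (B (h - x h))) \<and> (\<forall>h\<in>H2. z h = Qt (B h))"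
    (is "B = ?R \<longleftrightarrow> ?eq \<and> ?w \<and> ?z")
proof -
  interpret h: orthogonal_sum H1 H2 by fact
  interpret k: orthogonal_sum K1 K2 by fact
  interpret kc: orthogonal_sum K2 K1 by (rule k.sum_commute)
  have xH: "x h \<in> H2" if "h \<in> H1" for h using bounded_opsD(1)[OF x that] .
  have K1: "orth_proj K1 (y v) = y v" "orth_proj K2 (y v) = 0" if "v \<in> K2" for v
    using bounded_opsD(1)[OF y that] by (simp_all add: k.proj_of_mem kc.proj_of_mem_compl)
  have wK: "w h \<in> K2" if "h \<in> H1" for h using bounded_opsD(1)[OF w that] .
  have zK: "z h \<in> K1" if "h \<in> H2" for h using bounded_opsD(1)[OF z that] .
  have xq: "x (orth_proj H1 u) + orth_proj H2 u \<in> H2" for u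
    using csubspaceD(2)[OF h.N(1)] xH by simp
  note Bd = bounded_ops_diff_arg[OF B csubspace_UNIV]
  define s where "s u = orth_proj K2 (B (x (orth_proj H1 u))) + orth_proj K2 (B (orth_proj H2 u))
    + w (orth_proj H1 u)" for u
  have sK: "s u \<in> K2" for u
    unfolding s_def by (intro csubspaceD(2)[OF k.N(1)] wK) auto
  \<comment> \<open>Linearity gathers all entries beginning with \<open>y\<close> into
    \<open>y (s u)\<close>, and likewise those beginning with \<open>z\<close>.\<close>
  have R: "?R u = (A u + y (s u) + z (x (orth_proj H1 u) + orth_proj H2 u)) + s u" for u
  proof -
    let ?p = "orth_proj H1 u" and ?q = "orth_proj H2 u"
    have "y (s u) = y (b22 (x ?p)) + y (b22 ?q) + y (w ?p)"
      unfolding s_def b22_def block_entry_def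
      by (simp add: bounded_opsD(2)[OF y] wK csubspaceD(2)[OF k.N(1)])
    moreover have "z (x ?p + ?q) = z (x ?p) + z ?q"
      by (simp add: bounded_opsD(2)[OF z] xH)
    ultimately show ?thesis
      by (simp add: block_op_def a_def s_def b22_def block_entry_def AH AK k.proj_of_mem ac_simps)
  qed
  have Qt: "Qt v = orth_proj K1 v - y (orth_proj K2 v)" for v
    by (simp add: Qt_def k.oblique_onto_def)
  have Qtd: "Qt (u - v) = Qt u - Qt v" for u v
    by (simp add: Qt k.proj_linear kc.proj_linear bounded_ops_diff_arg[OF y k.N(1)])
  have Q: "Q u = orth_proj H1 u - x (orth_proj H1 u)" for u
    by (simp add: Q_def h.oblique_along_def)
  show ?thesis
  proof
    assume BR: "B = ?R"
    have BR': "B u = (A u + y (s u) + z (x (orth_proj H1 u) + orth_proj H2 u)) + s u" for u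
      using R[of u] fun_cong[OF BR, of u] by simp
    have zx: "z (x (orth_proj H1 u) + orth_proj H2 u) \<in> K1" for u using zK[OF xq] .
    have row2: "orth_proj K2 (B u) = s u" for u
      unfolding BR' by (simp add: kc.proj_linear K1 sK AK zx kc.proj_of_mem kc.proj_of_mem_compl)
    have row1: "Qt (B u) = A u + z (x (orth_proj H1 u) + orth_proj H2 u)" for u
    proof -
      have "orth_proj K1 (B u) = A u + y (s u) + z (x (orth_proj H1 u) + orth_proj H2 u)"
        unfolding BR' by (simp add: k.proj_linear K1 sK AK zx k.proj_of_mem k.proj_of_mem_compl)
      then show ?thesis by (simp add: Qt row2)
    qed
    \<comment> \<open>On vectors \<open>h - x h\<close>, which make up the range of
      \<open>Q\<close>, the argument of \<open>z\<close> in \<open>row1\<close> is therefore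
      zero.\<close>
    have hx: "orth_proj H1 (h - x h) = h" "orth_proj H2 (h - x h) = - x h" if "h \<in> H1" for h
    proof -
      show 1: "orth_proj H1 (h - x h) = h"
        using that by (simp add: h.proj_linear h.proj_of_mem h.proj_of_mem_compl xH)
      show "orth_proj H2 (h - x h) = - x h" using h.decomposition[of "h - x h"] 1
        by (simp add: eq_neg_iff_add_eq_0 add.commute)
    qed
    have ?eq
    proof
      fix u
      have "Qt (B (Q u)) = A (Q u)"
        unfolding row1 by (simp add: Q hx bounded_ops_zero_arg[OF z h.N(1)])
      also have "\<dots> = A u" using AH[of "Q u"] AH[of u] by (simp add: Q hx)
      finally show "A u = (Qt \<circ> B \<circ> Q) u" by simp
    qed
    \<comment> \<open>In \<open>s (h - x h)\<close> the two terms with \<open>B (x h)\<close> cancel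
      and only \<open>w h\<close> is left.\<close>
    moreover have ?w
      unfolding row2 by (simp add: s_def hx bounded_ops_minus_arg[OF B] 
          bounded_ops_minus_arg[OF kc.proj_bounded_ops])
    \<comment> \<open>On \<open>H2\<close> both \<open>A\<close> and the term with \<open>x\<close>
      vanish, so \<open>row1\<close> reduces to \<open>z h\<close>.\<close>
    moreover have ?z
    proof
      fix h assume h: "h \<in> H2"
      have p: "orth_proj H1 h = 0" "orth_proj H2 h = h"
        using h.proj_of_mem_compl[OF h] h.decomposition[of h] by simp_all
      have "A h = 0" using AH[of h] p bounded_ops_zero_arg[OF A csubspace_UNIV] by simp
      then show "z h = Qt (B h)"
        unfolding row1 by (simp add: p bounded_ops_zero_arg[OF x h.M(1)])
    qed
    ultimately show "?eq \<and> ?w \<and> ?z" by blast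
  next
    assume *: "?eq \<and> ?w \<and> ?z"
    show "B = ?R"
    proof
      fix u
      let ?p = "orth_proj H1 u" and ?q = "orth_proj H2 u"
      have Bu: "B u = B ?p + B ?q"
        using bounded_opsD(2)[OF B, of ?p ?q] h.decomposition[of u] by simp
      \<comment> \<open>Inserting the formula for \<open>w\<close> cancels the term with
        \<open>x ?p\<close>.\<close>
      have s: "s u = orth_proj K2 (B u)"
        using * by (simp add: s_def Bu Bd kc.proj_linear)
      \<comment> \<open>This is the vector in \<open>H2\<close> to which \<open>z\<close> is
        applied, so the \<open>z\<close> term becomes \<open>Qt B (I - Q) u\<close>, that is
        \<open>Qt (B u) - A u\<close>.\<close>
      have "u - Q u = x ?p + ?q" using h.decomposition[of u] by (simp add: Q algebra_simps)
      then have "z (x ?p + ?q) = Qt (B (u - Q u))" using * xq[of u] by simp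
      also have "\<dots> = Qt (B u) - A u" using * by (simp add: Bd Qtd fun_eq_iff)
      finally have "?R u = orth_proj K1 (B u) + orth_proj K2 (B u)"
        unfolding R by (simp add: s Qt)
      then show "B u = ?R u" by (simp only: k.decomposition)
    qed
  qed
qed

theorem theorem3p10:
  fixes A B :: "'h::complex_hilbert \<Rightarrow> 'k::complex_hilbert"
  defines "H1 \<equiv> closure (range (cadjoint A))" and "H2 \<equiv> nullspace A"
    and "K1 \<equiv> closure (range A)" and "K2 \<equiv> nullspace (cadjoint A)"
  defines "a \<equiv> block_entry K1 A" and "b22 \<equiv> block_entry K2 B"
  assumes "A \<in> bounded_ops UNIV UNIV" and "B \<in> bounded_ops UNIV UNIV"
  shows
    "(plus_le A B \<longleftrightarrow>
       (\<exists>y \<in> bounded_ops K2 K1. \<exists>x \<in> bounded_ops H1 H2.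
        \<exists>w \<in> bounded_ops H1 K2. \<exists>z \<in> bounded_ops H2 K1.
          B = (\<lambda>u.
                block_op H1 H2 (\<lambda>h. a h + y (b22 (x h))) (\<lambda>h. y (b22 h)) (\<lambda>h. b22 (x h)) b22 u
              + block_op H1 H2 (\<lambda>h. y (w h)) (\<lambda>_. 0) w (\<lambda>_. 0) u
              + block_op H1 H2 (\<lambda>h. z (x h)) z (\<lambda>_. 0) (\<lambda>_. 0) u) \<and>
          range (block_op H1 H2 (\<lambda>h. y (w h)) (\<lambda>_. 0) w (\<lambda>_. 0)) \<subseteq> range B \<and>
          range (block_op K1 K2 (\<lambda>k. adjoint_on H1 x (adjoint_on H2 z k)) (\<lambda>_. 0)
                   (adjoint_on H2 z) (\<lambda>_. 0))
            \<subseteq> range (cadjoint B)))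
     \<and>
     (plus_le A B \<longleftrightarrow>
       (\<exists>Qt Q. projection_op Qt \<and> projection_op Q \<and> A = Qt \<circ> B \<circ> Q \<and>
          range (\<lambda>u. B (Q u) - Qt (B (Q u))) \<subseteq> range B \<and>
          range (cadjoint (\<lambda>u. Qt (B (u - Q u)))) \<subseteq> range (cadjoint B)))"
proof -
  note A = assms(7) and B = assms(8)
  have H: "orthogonal_sum H1 H2" and K: "orthogonal_sum K1 K2"
    using orthogonal_sum_operator[OF A] by (simp_all add: H1_def H2_def K1_def K2_def)
  interpret h: orthogonal_sum H1 H2 by (rule H)
  interpret k: orthogonal_sum K1 K2 by (rule K)
  interpret kc: orthogonal_sum K2 K1 by (rule k.sum_commute)
  have AK: "A u \<in> K1" for u using closure_subset[of "range A"] by (auto simp: K1_def)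
  have AH: "A (orth_proj H1 u) = A u" for u
    unfolding H1_def using A by (rule operator_orth_proj)
  \<comment> \<open>With these values of \<open>w\<close> and \<open>z\<close>, the range conditions
    on the matrices are literally those on the oblique projections.\<close>
  have corr: "block_op H1 H2 (\<lambda>h. y (w h)) (\<lambda>_. 0) w (\<lambda>_. 0)
        = (\<lambda>u. B (h.oblique_along x u) - k.oblique_onto y (B (h.oblique_along x u)))
      \<and> block_op K1 K2 (\<lambda>k. adjoint_on H1 x (adjoint_on H2 z k)) (\<lambda>_. 0) (adjoint_on H2 z) (\<lambda>_. 0)
        = cadjoint (\<lambda>u. k.oblique_onto y (B (u - h.oblique_along x u)))"
    if y: "y \<in> bounded_ops K2 K1" and x: "x \<in> bounded_ops H1 H2"
      and z: "z \<in> bounded_ops H2 K1"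
      and w_eq: "\<forall>h\<in>H1. w h = orth_proj K2 (B (h - x h))"
      and z_eq: "\<forall>h\<in>H2. z h = k.oblique_onto y (B h)" for y x w z
  proof
    let ?Qt = "k.oblique_onto y" and ?Q = "h.oblique_along x"
    have Qt: "?Qt \<in> bounded_ops UNIV UNIV" and Q: "?Q \<in> bounded_ops UNIV UNIV"
      using k.projection_oblique_onto[OF y] h.projection_oblique_along[OF x]
      by (simp_all add: projection_op_def)
    \<comment> \<open>\<open>I - Qt\<close> has matrix \<open>(0 y; 0 1)\<close>; applied to
      \<open>B (?Q u)\<close> it produces the entries \<open>y w\<close> and \<open>w\<close>
      together.\<close>
    have dec: "v - ?Qt v = y (orth_proj K2 v) + orth_proj K2 v" for v
      using k.decomposition[of v] by (simp add: k.oblique_onto_def algebra_simps)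
    show "block_op H1 H2 (\<lambda>h. y (w h)) (\<lambda>_. 0) w (\<lambda>_. 0) = (\<lambda>u. B (?Q u) - ?Qt (B (?Q u)))"
      unfolding dec using w_eq by (simp add: fun_eq_iff block_op_def h.oblique_along_def)
    show "block_op K1 K2 (\<lambda>k. adjoint_on H1 x (adjoint_on H2 z k)) (\<lambda>_. 0) (adjoint_on H2 z) (\<lambda>_. 0)
        = cadjoint (\<lambda>u. ?Qt (B (u - ?Q u)))"
    proof (rule adjoint_block_op[OF H K _ x z])
      show "(\<lambda>u. ?Qt (B (u - ?Q u))) \<in> bounded_ops UNIV UNIV"
        by (rule bounded_ops_compose[OF bounded_ops_compose[OF bounded_ops_diff[OF csubspace_UNIV
              bounded_ops_id[OF order_refl] Q] B] Qt])
      fix u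
      have "u - ?Q u = x (orth_proj H1 u) + orth_proj H2 u"
        using h.decomposition[of u] by (simp add: h.oblique_along_def algebra_simps)
      moreover have "x (orth_proj H1 u) + orth_proj H2 u \<in> H2"
        using csubspaceD(2)[OF h.N(1)] bounded_opsD(1)[OF x] by simp
      ultimately show "?Qt (B (u - ?Q u)) = z (x (orth_proj H1 u) + orth_proj H2 u)"
        using z_eq by simp
    qed
  qed
  \<comment> \<open>The values forced on \<open>w\<close> and \<open>z\<close> do define bounded
    operators between the required summands, so they can serve as witnesses.\<close>
  have wz: "(\<lambda>h. orth_proj K2 (B (h - x h))) \<in> bounded_ops H1 K2
      \<and> (\<lambda>h. k.oblique_onto y (B h)) \<in> bounded_ops H2 K1"
    if y: "y \<in> bounded_ops K2 K1" and x: "x \<in> bounded_ops H1 H2" for y x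
  proof
    have "(\<lambda>h. h - x h) \<in> bounded_ops H1 UNIV"
      by (intro bounded_ops_diff csubspace_UNIV bounded_ops_id bounded_ops_subset[OF x]) auto
    then show "(\<lambda>h. orth_proj K2 (B (h - x h))) \<in> bounded_ops H1 K2"
      by (rule bounded_ops_compose[OF bounded_ops_compose[OF _ B] kc.proj_bounded_ops])
    have "k.oblique_onto y \<in> bounded_ops UNIV K1"
      unfolding k.oblique_onto_def
      by (intro bounded_ops_diff k.M(1) k.proj_bounded_ops
          bounded_ops_compose[OF kc.proj_bounded_ops y])
    then show "(\<lambda>h. k.oblique_onto y (B h)) \<in> bounded_ops H2 K1"
      by (rule bounded_ops_compose[OF bounded_ops_subset[OF B subset_UNIV order_refl]])
  qed
  note repr = block_representation_iff[OF H K A B AK AH, folded a_def b22_def]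
  note plus = plus_le_iff_oblique[OF A B, folded H1_def H2_def K1_def K2_def]
  show ?thesis (is "(_ \<longleftrightarrow> ?matrix) \<and> _")
  proof
    show "plus_le A B \<longleftrightarrow> ?matrix"
    proof
      assume "plus_le A B"
      then obtain y x where y: "y \<in> bounded_ops K2 K1" and x: "x \<in> bounded_ops H1 H2"
        and eq: "A = k.oblique_onto y \<circ> B \<circ> h.oblique_along x"
        and r: "range (\<lambda>u. B (h.oblique_along x u) - k.oblique_onto y (B (h.oblique_along x u)))
            \<subseteq> range B"
          "range (cadjoint (\<lambda>u. k.oblique_onto y (B (u - h.oblique_along x u)))) \<subseteq> range (cadjoint B)"
        unfolding plus by blast
      let ?w = "\<lambda>h. orth_proj K2 (B (h - x h))" and ?z = "\<lambda>h. k.oblique_onto y (B h)"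
      have w: "?w \<in> bounded_ops H1 K2" and z: "?z \<in> bounded_ops H2 K1" using wz[OF y x] by auto
      have wz_eq: "\<forall>h\<in>H1. ?w h = orth_proj K2 (B (h - x h))"
        "\<forall>h\<in>H2. ?z h = k.oblique_onto y (B h)"
        by simp_all
      note B_eq = iffD2[OF repr[OF y x w z] conjI[OF eq conjI[OF wz_eq]]]
      show ?matrix
        using r
        by (intro bexI[OF _ y] bexI[OF _ x] bexI[OF _ w] bexI[OF _ z] conjI B_eq)
          (simp_all only: corr[OF y x z wz_eq])
    next
      assume ?matrix
      then obtain y x w z where y: "y \<in> bounded_ops K2 K1" and x: "x \<in> bounded_ops H1 H2"
        and w: "w \<in> bounded_ops H1 K2" and z: "z \<in> bounded_ops H2 K1"
        and eq: "B = (\<lambda>u.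
                block_op H1 H2 (\<lambda>h. a h + y (b22 (x h))) (\<lambda>h. y (b22 h)) (\<lambda>h. b22 (x h)) b22 u
              + block_op H1 H2 (\<lambda>h. y (w h)) (\<lambda>_. 0) w (\<lambda>_. 0) u
              + block_op H1 H2 (\<lambda>h. z (x h)) z (\<lambda>_. 0) (\<lambda>_. 0) u)"
        and r: "range (block_op H1 H2 (\<lambda>h. y (w h)) (\<lambda>_. 0) w (\<lambda>_. 0)) \<subseteq> range B"
          "range (block_op K1 K2 (\<lambda>k. adjoint_on H1 x (adjoint_on H2 z k)) (\<lambda>_. 0)
             (adjoint_on H2 z) (\<lambda>_. 0)) \<subseteq> range (cadjoint B)"
        by blast
      \<comment> \<open>Conversely, the given \<open>w\<close> and \<open>z\<close> must have these
        values, so \<open>corr\<close> applies to them.\<close>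
      have wz_eq: "A = k.oblique_onto y \<circ> B \<circ> h.oblique_along x"
        "\<forall>h\<in>H1. w h = orth_proj K2 (B (h - x h))" "\<forall>h\<in>H2. z h = k.oblique_onto y (B h)"
        using iffD1[OF repr[OF y x w z] eq] by blast+
      show "plus_le A B"
        unfolding plus using y x wz_eq(1) r corr[OF y x z wz_eq(2,3)] by auto
    qed
  qed (rule plus_le_iff_range_conditions[OF A B])
qed

end
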